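(* Let $D$ be a Dedekind domain that is not a field and let $M$ be a finitely generated $D$-module with torsion submodule $\tau(M)$. Then $$M\text{ is a C4-module}\iff \operatorname{rank}_D M\le1\text{ and }\tau(M)\text{ is a C4-module}.$$
   Context: A module $M$ is a C4-module if, whenever $M=A\oplus B$ (internal direct sum) and $f:A\to B$ is a homomorphism such that $\ker f$ is a direct summand of $A$, the image $\operatorname{Im} f$ is a direct summand of $B$. $\tau(M)=\{x\in M: xd=0\text{ for some }0\ne d\in D\}$, and $\operatorname{rank}_D M=\dim_K(K\otimes_D M)$ with $K$ the fraction field of $D$. *)

theory Defs
  imports
    "HOL-Algebra.Ring_Divisibility"
    "HOL-Algebra.Free_Abelian_Groups"
    "HOL-Computational_Algebra.Polynomial_Factorial"
    "Jordan_Normal_Form.VS_Connect"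
begin

section \<open>Dedekind domains\<close>

definition integrally_closed_domain :: "'a::idom itself \<Rightarrow> bool" where
  "integrally_closed_domain _ \<longleftrightarrow>
     (\<forall>x :: 'a fract.
        (\<exists>p :: 'a poly. lead_coeff p = 1 \<and> poly (map_poly to_fract p) x = 0)
          \<longrightarrow> x \<in> range to_fract)"

text \<open>
  Noetherian, integrally closed, and every nonzero prime ideal maximal. Fields are included;
  they are excluded separately where necessary.
\<close>

definition dedekind_domain :: "'a::idom itself \<Rightarrow> bool" where
  "dedekind_domain _ \<longleftrightarrow>
     noetherian_domain (class_ring :: 'a ring) \<and>
     integrally_closed_domain TYPE('a) \<and>
     (\<forall>P. primeideal P (class_ring :: 'a ring) \<and> P \<noteq> {0}
        \<longrightarrow> maximalideal P (class_ring :: 'a ring))"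


section \<open>Direct summands, C4-modules, torsion\<close>

text \<open>
  A module is a submodule \<open>N\<close> of an ambient module given by the type \<open>'b\<close> and the scalar
  multiplication \<open>s\<close>; the ambient module itself is \<open>N = UNIV\<close>. All notions below are intrinsic
  to \<open>N\<close>: they only involve submodules contained in \<open>N\<close>. A homomorphism between submodules is a
  function on the type of which only the values on the source matter.
\<close>

definition internal_direct_sum ::
    "('a::comm_ring_1 \<Rightarrow> 'b::ab_group_add \<Rightarrow> 'b) \<Rightarrow> 'b set \<Rightarrow> 'b set \<Rightarrow> 'b set \<Rightarrow> bool" where
  "internal_direct_sum s N A B \<longleftrightarrow>
     Modules.module.subspace s A \<and> Modules.module.subspace s B \<and>
     N = {a + b | a b. a \<in> A \<and> b \<in> B} \<and> A \<inter> B = {0}"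

definition direct_summand ::
    "('a::comm_ring_1 \<Rightarrow> 'b::ab_group_add \<Rightarrow> 'b) \<Rightarrow> 'b set \<Rightarrow> 'b set \<Rightarrow> bool" where
  "direct_summand s N A \<longleftrightarrow> (\<exists>B. internal_direct_sum s N A B)"

definition submodule_hom ::
    "('a::comm_ring_1 \<Rightarrow> 'b::ab_group_add \<Rightarrow> 'b) \<Rightarrow> 'b set \<Rightarrow> 'b set \<Rightarrow> ('b \<Rightarrow> 'b) \<Rightarrow> bool" where
  "submodule_hom s A B f \<longleftrightarrow>
     f \<in> A \<rightarrow> B \<and>
     (\<forall>x\<in>A. \<forall>y\<in>A. f (x + y) = f x + f y) \<and>
     (\<forall>r. \<forall>x\<in>A. f (s r x) = s r (f x))"

definition C4_module ::
    "('a::comm_ring_1 \<Rightarrow> 'b::ab_group_add \<Rightarrow> 'b) \<Rightarrow> 'b set \<Rightarrow> bool" where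
  "C4_module s N \<longleftrightarrow>
     (\<forall>A B f. internal_direct_sum s N A B \<and> submodule_hom s A B f \<and>
        direct_summand s A {x \<in> A. f x = 0} \<longrightarrow> direct_summand s B (f ` A))"

definition torsion_submodule :: "('a::idom \<Rightarrow> 'b::ab_group_add \<Rightarrow> 'b) \<Rightarrow> 'b set" where
  "torsion_submodule s = {x. \<exists>d. d \<noteq> 0 \<and> s d x = 0}"


section \<open>Extension of scalars to the fraction field, and rank\<close>

text \<open>
  The tensor product over \<open>'r\<close> of two modules with scalar multiplications \<open>s1\<close> and \<open>s2\<close>:
  the free abelian group on all pairs, modulo the subgroup generated by the relations making
  \<open>(x, y) \<mapsto> x \<otimes> y\<close> biadditive and \<open>'r\<close>-balanced.
\<close>

definition tensor_relators ::
    "('r \<Rightarrow> 'a::ab_group_add \<Rightarrow> 'a) \<Rightarrow> ('r \<Rightarrow> 'b::ab_group_add \<Rightarrow> 'b) \<Rightarrow> ('a \<times> 'b \<Rightarrow>\<^sub>0 int) set" where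
  "tensor_relators s1 s2 =
     {frag_of (x + x', y) - frag_of (x, y) - frag_of (x', y) | x x' y. True} \<union>
     {frag_of (x, y + y') - frag_of (x, y) - frag_of (x, y') | x y y'. True} \<union>
     {frag_of (s1 r x, y) - frag_of (x, s2 r y) | r x y. True}"

definition tensor_null ::
    "('r \<Rightarrow> 'a::ab_group_add \<Rightarrow> 'a) \<Rightarrow> ('r \<Rightarrow> 'b::ab_group_add \<Rightarrow> 'b) \<Rightarrow> ('a \<times> 'b \<Rightarrow>\<^sub>0 int) set" where
  "tensor_null s1 s2 = generate (free_Abelian_group UNIV) (tensor_relators s1 s2)"

definition tensor_group ::
    "('r \<Rightarrow> 'a::ab_group_add \<Rightarrow> 'a) \<Rightarrow> ('r \<Rightarrow> 'b::ab_group_add \<Rightarrow> 'b) \<Rightarrow> ('a \<times> 'b \<Rightarrow>\<^sub>0 int) set monoid" where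
  "tensor_group s1 s2 = free_Abelian_group UNIV Mod tensor_null s1 s2"

abbreviation fract_scale :: "'a::idom \<Rightarrow> 'a fract \<Rightarrow> 'a fract" where
  "fract_scale d q \<equiv> to_fract d * q"

text \<open>
  The vector space \<open>K \<otimes> M\<close> over the fraction field \<open>K\<close>; a scalar \<open>k\<close> acts on cosets by
  \<open>k (q \<otimes> m) = (k q) \<otimes> m\<close>. The record type is that of algebras, so its multiplicative fields
  carry no information.
\<close>

definition fract_tensor ::
    "('a::idom \<Rightarrow> 'b::ab_group_add \<Rightarrow> 'b) \<Rightarrow> ('a fract, ('a fract \<times> 'b \<Rightarrow>\<^sub>0 int) set) module" where
  "fract_tensor s =
     \<lparr>carrier = carrier (tensor_group fract_scale s),
      mult = undefined,
      one = undefined,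
      ring.zero = one (tensor_group fract_scale s),
      add = monoid.mult (tensor_group fract_scale s),
      smult = (\<lambda>k X. the_elem
        ((\<lambda>c. tensor_null fract_scale s #>\<^bsub>free_Abelian_group UNIV\<^esub>
                frag_extend (\<lambda>(q, m). frag_of (k * q, m)) c) ` X))\<rparr>"

lemma subgroup_tensor_null: "subgroup (tensor_null s1 s2) (free_Abelian_group UNIV)"
  unfolding tensor_null_def by (rule group.generate_is_subgroup) auto

lemma comm_group_tensor_group: "comm_group (tensor_group s1 s2)"
  unfolding tensor_group_def
  by (rule comm_group.abelian_FactGroup[OF abelian_free_Abelian_group subgroup_tensor_null])

lemma tensor_null_add: "x \<in> tensor_null s1 s2 \<Longrightarrow> y \<in> tensor_null s1 s2 \<Longrightarrow> x + y \<in> tensor_null s1 s2"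
  using subgroup.m_closed[OF subgroup_tensor_null] by fastforce

lemma tensor_null_minus: "x \<in> tensor_null s1 s2 \<Longrightarrow> - x \<in> tensor_null s1 s2"
  using subgroup.m_inv_closed[OF subgroup_tensor_null] by fastforce

lemma tensor_null_zero: "0 \<in> tensor_null s1 s2"
  using subgroup.one_closed[OF subgroup_tensor_null] by fastforce

lemma tensor_null_diff: "x \<in> tensor_null s1 s2 \<Longrightarrow> y \<in> tensor_null s1 s2 \<Longrightarrow> x - y \<in> tensor_null s1 s2"
  using tensor_null_add[OF _ tensor_null_minus] by fastforce

abbreviation tensor_coset where
  "tensor_coset s1 s2 c \<equiv> tensor_null s1 s2 #>\<^bsub>free_Abelian_group UNIV\<^esub> c"

lemma mem_tensor_coset: "x \<in> tensor_coset s1 s2 c \<longleftrightarrow> x - c \<in> tensor_null s1 s2"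
  unfolding r_coset_def by (force simp: algebra_simps)

lemma tensor_coset_eq_iff:
  "tensor_coset s1 s2 c = tensor_coset s1 s2 d \<longleftrightarrow> c - d \<in> tensor_null s1 s2"
proof
  assume "tensor_coset s1 s2 c = tensor_coset s1 s2 d"
  moreover have "c \<in> tensor_coset s1 s2 c"
    by (simp add: mem_tensor_coset tensor_null_zero)
  ultimately show "c - d \<in> tensor_null s1 s2" by (simp add: mem_tensor_coset)
next
  assume a: "c - d \<in> tensor_null s1 s2"
  show "tensor_coset s1 s2 c = tensor_coset s1 s2 d"
  proof (rule Set.set_eqI)
    fix x
    have "x - d = (x - c) + (c - d)" "x - c = (x - d) - (c - d)" by simp_all
    then show "x \<in> tensor_coset s1 s2 c \<longleftrightarrow> x \<in> tensor_coset s1 s2 d"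
      unfolding mem_tensor_coset by (metis a tensor_null_add tensor_null_diff)
  qed
qed

lemma carrier_tensor_group: "carrier (tensor_group s1 s2) = range (tensor_coset s1 s2)"
  unfolding tensor_group_def carrier_FactGroup by (simp add: free_Abelian_group_def)

lemma mult_tensor_coset:
  "tensor_coset s1 s2 c \<otimes>\<^bsub>tensor_group s1 s2\<^esub> tensor_coset s1 s2 d = tensor_coset s1 s2 (c + d)"
proof -
  have "tensor_null s1 s2 \<lhd> free_Abelian_group UNIV"
    by (simp add: comm_group.normal_iff_subgroup[OF abelian_free_Abelian_group] subgroup_tensor_null)
  from normal.rcos_sum[OF this, of c d] show ?thesis
    by (simp add: tensor_group_def)
qed

lemma frag_extend_scale_tensor_relators:
  assumes "h \<in> tensor_relators fract_scale s"
  shows "frag_extend (\<lambda>(q, m). frag_of (k * q, m)) h \<in> tensor_relators fract_scale s"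
proof -
  consider
    (l) x x' y where "h = frag_of (x + x', y) - frag_of (x, y) - frag_of (x', y)"
  | (r) x y y' where "h = frag_of (x, y + y') - frag_of (x, y) - frag_of (x, y')"
  | (b) d x y where "h = frag_of (fract_scale d x, y) - frag_of (x, s d y)"
    using assms unfolding tensor_relators_def by blast
  then show ?thesis
  proof cases
    case l
    then have "frag_extend (\<lambda>(q, m). frag_of (k * q, m)) h
        = frag_of (k * x + k * x', y) - frag_of (k * x, y) - frag_of (k * x', y)"
      by (simp add: frag_extend_diff distrib_left)
    then show ?thesis unfolding tensor_relators_def by blast
  next
    case r
    then have "frag_extend (\<lambda>(q, m). frag_of (k * q, m)) h
        = frag_of (k * x, y + y') - frag_of (k * x, y) - frag_of (k * x, y')"
      by (simp add: frag_extend_diff)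
    then show ?thesis unfolding tensor_relators_def by blast
  next
    case b
    then have "frag_extend (\<lambda>(q, m). frag_of (k * q, m)) h
        = frag_of (fract_scale d (k * x), y) - frag_of (k * x, s d y)"
      by (simp add: frag_extend_diff mult.left_commute)
    then show ?thesis unfolding tensor_relators_def by blast
  qed
qed

lemma frag_extend_scale_tensor_null:
  assumes "c \<in> tensor_null fract_scale s"
  shows "frag_extend (\<lambda>(q, m). frag_of (k * q, m)) c \<in> tensor_null fract_scale s"
  using assms unfolding tensor_null_def
proof (induction rule: generate.induct)
  case one
  then show ?case by (simp add: tensor_null_zero[unfolded tensor_null_def])
next
  case (incl h)
  have "frag_extend (\<lambda>(q, m). frag_of (k * q, m)) h \<in> tensor_relators fract_scale s"
    using incl by (rule frag_extend_scale_tensor_relators)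
  then show ?case by (rule generate.incl)
next
  case (inv h)
  have "frag_extend (\<lambda>(q, m). frag_of (k * q, m)) h \<in> tensor_relators fract_scale s"
    using inv by (rule frag_extend_scale_tensor_relators)
  then show ?case
    using tensor_null_minus[unfolded tensor_null_def, OF generate.incl] by (simp add: frag_extend_minus)
next
  case (eng h1 h2)
  then show ?case
    using tensor_null_add[unfolded tensor_null_def] by (simp add: frag_extend_add)
qed

lemma smult_tensor_coset:
  "k \<odot>\<^bsub>fract_tensor s\<^esub> tensor_coset fract_scale s c
     = tensor_coset fract_scale s (frag_extend (\<lambda>(q, m). frag_of (k * q, m)) c)"
proof -
  let ?a = "frag_extend (\<lambda>(q, m). frag_of (k * q, m))"
  have "tensor_coset fract_scale s (?a x) = tensor_coset fract_scale s (?a c)"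
    if "x \<in> tensor_coset fract_scale s c" for x
    using frag_extend_scale_tensor_null[of "x - c" s k] that
    by (simp add: tensor_coset_eq_iff mem_tensor_coset frag_extend_diff)
  moreover have "c \<in> tensor_coset fract_scale s c"
    by (simp add: mem_tensor_coset tensor_null_zero)
  ultimately have "(\<lambda>x. tensor_coset fract_scale s (?a x)) ` tensor_coset fract_scale s c
      = {tensor_coset fract_scale s (?a c)}"
    by blast
  then show ?thesis by (simp add: fract_tensor_def)
qed

lemma vectorspace_fract_tensor: "vectorspace (class_ring :: 'a fract ring) (fract_tensor s)"
  for s :: "'a::idom \<Rightarrow> 'b::ab_group_add \<Rightarrow> 'b"
proof -
  let ?V = "fract_tensor s" and ?T = "tensor_group fract_scale s"
  let ?C = "tensor_coset fract_scale s" and ?N = "tensor_null fract_scale s"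
  let ?a = "\<lambda>k. frag_extend (\<lambda>(q, m). frag_of (k * q, m)) :: ('a fract \<times> 'b \<Rightarrow>\<^sub>0 int) \<Rightarrow> _"
  interpret T: comm_group ?T by (rule comm_group_tensor_group)
  have ab: "abelian_group ?V"
  proof (rule abelian_groupI)
    fix x assume "x \<in> carrier ?V"
    then show "\<exists>y\<in>carrier ?V. y \<oplus>\<^bsub>?V\<^esub> x = \<zero>\<^bsub>?V\<^esub>"
      using T.l_inv_ex[of x] by (simp add: fract_tensor_def)
  qed (simp_all add: fract_tensor_def T.m_ac)
  have car: "carrier ?V = range ?C" by (simp add: fract_tensor_def carrier_tensor_group)
  have plus: "?C c \<oplus>\<^bsub>?V\<^esub> ?C d = ?C (c + d)" for c d
    using mult_tensor_coset by (simp add: fract_tensor_def)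
  have l: "?a (k + l) c - (?a k c + ?a l c) \<in> ?N" for k l c
  proof -
    have "Poly_Mapping.keys c \<subseteq> UNIV" by simp
    then show ?thesis
    proof (induction c rule: frag_induction)
      case zero
      then show ?case by (simp add: tensor_null_zero)
    next
      case (one x)
      obtain q m where x: "x = (q, m)" by force
      have "frag_of (k * q + l * q, m) - frag_of (k * q, m) - frag_of (l * q, m)
          \<in> tensor_relators fract_scale s"
        unfolding tensor_relators_def by blast
      then show ?case
        by (simp add: x tensor_null_def generate.incl algebra_simps)
    next
      case (diff c d)
      show ?case
        using tensor_null_diff[OF diff] by (simp add: frag_extend_diff algebra_simps)
    qed
  qed
  have assoc: "?a (k * l) c = ?a k (?a l c)" and unit: "?a 1 c = c" for k l c
  proof -
    have "Poly_Mapping.keys c \<subseteq> UNIV" by simp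
    then show "?a (k * l) c = ?a k (?a l c)"
      by (induction c rule: frag_induction) (auto simp: frag_extend_diff mult.assoc)
    have "Poly_Mapping.keys c \<subseteq> UNIV" by simp
    then show "?a 1 c = c"
      by (induction c rule: frag_induction) (auto simp: frag_extend_diff)
  qed
  have "module (class_ring :: 'a fract ring) ?V"
  proof (rule Module.moduleI[OF class_cring.is_cring ab], goal_cases)
    case (1 k X)
    then show ?case by (auto simp: car smult_tensor_coset)
  next
    case (2 k l X)
    then obtain c where "X = ?C c" by (auto simp: car)
    then show ?case
      using l[of k l c] by (simp add: smult_tensor_coset plus tensor_coset_eq_iff del: minus_add_distrib)
  next
    case (3 k X Y)
    then show ?case by (auto simp: car smult_tensor_coset plus frag_extend_add)
  next
    case (4 k l X)
    then show ?case by (auto simp: car smult_tensor_coset assoc)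
  next
    case (5 X)
    then obtain c where "X = ?C c" by (auto simp: car)
    then show ?case using unit[of c] by (simp add: smult_tensor_coset)
  qed
  then show ?thesis using class_field by (intro vectorspace.intro)
qed

definition module_rank :: "('a::idom \<Rightarrow> 'b::ab_group_add \<Rightarrow> 'b) \<Rightarrow> nat" where
  "module_rank s = vectorspace.dim (class_ring :: 'a fract ring) (fract_tensor s)"

end

theory Submission
  imports Defs
begin

text \<open>
  In a Dedekind domain every nonzero ideal is invertible, so a nonzero functional \<open>\<phi>\<close> on a
  module \<open>M\<close> splits: \<open>M = Q \<oplus> ker \<phi>\<close> with \<open>Q \<cong> im \<phi>\<close>. If \<open>x\<close> and \<open>y\<close> are independent, take \<open>\<phi>\<close> with
  \<open>\<phi> x \<noteq> 0\<close> and \<open>\<phi> y = 0\<close>; for a nonzero nonunit \<open>d\<close> the map \<open>q \<mapsto> \<phi> q \<cdot> (d y)\<close> from \<open>Q\<close> to \<open>ker \<phi>\<close> is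
  injective, and if its image were a direct summand, then \<open>im \<phi> = d \<cdot> im \<phi>\<close>, which is impossible.
  Hence a C4-module has rank at most one. In rank at most one a single functional has the torsion
  submodule as its kernel, so the latter is a direct summand. Conversely, given \<open>M = A \<oplus> B\<close> and
  \<open>f : A \<rightarrow> B\<close> whose kernel has a complement \<open>L\<close>, the rank bound forces \<open>L\<close> to be torsion, so
  \<open>f\<close> has the same image as its restriction to the torsion submodules.
\<close>

section \<open>Invertibility of ideals\<close>

interpretation self: Modules.module "(*) :: 'a::comm_ring_1 \<Rightarrow> 'a \<Rightarrow> 'a"
  by unfold_locales (simp_all add: algebra_simps)

text \<open>For multiplication this rule reads \<open>a * (b * x) = a * b * x\<close> and would loop
  against \<open>mult.assoc\<close>.\<close>

declare self.scale_scale [simp del]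

section \<open>Ideals as subspaces, ascending chains and integral elements\<close>

lemma ideal_class_ring_iff: "ideal I (class_ring :: 'a::comm_ring_1 ring) \<longleftrightarrow> self.subspace I"
proof
  assume "ideal I (class_ring :: 'a ring)"
  then interpret I: ideal I "class_ring :: 'a ring" .
  show "self.subspace I"
    using I.zero_closed I.a_closed I.I_l_closed by (intro self.subspaceI) auto
next
  assume I: "self.subspace I"
  show "ideal I (class_ring :: 'a ring)"
  proof (rule idealI)
    show "subgroup I (add_monoid (class_ring :: 'a ring))"
    proof
      fix x assume "x \<in> I"
      then show "inv\<^bsub>add_monoid (class_ring :: 'a ring)\<^esub> x \<in> I"
        using self.subspace_neg[OF I] class_ring_simps(8) unfolding a_inv_def by metis
    qed (use I self.subspace_0 self.subspace_add in auto)
  qed (use I self.subspace_scale[OF I] in \<open>auto simp: mult.commute class_ring.ring_axioms\<close>)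
qed

text \<open>This form of the chain condition serves both Zorn's lemma in
  \<open>noetherian_maximal\<close> and the increasing sequence of spans in
  \<open>integral_dvd\<close>.\<close>

lemma noetherian_Union_chain:
  assumes "noetherian_ring (class_ring :: 'a::comm_ring_1 ring)"
    and "C \<noteq> {}" and "\<And>I. I \<in> C \<Longrightarrow> self.subspace (I :: 'a set)"
    and "\<And>I J. I \<in> C \<Longrightarrow> J \<in> C \<Longrightarrow> I \<subseteq> J \<or> J \<subseteq> I"
  shows "\<Union>C \<in> C"
  using assms
  by (intro noetherian_ring.ideal_chain_is_trivial) (auto simp: pred_on.chain_def ideal_class_ring_iff)

lemma noetherian_maximal:
  assumes "noetherian_ring (class_ring :: 'a::comm_ring_1 ring)"
    and "\<C> \<noteq> {}" and "\<And>I. I \<in> \<C> \<Longrightarrow> self.subspace (I :: 'a set)"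
  obtains M where "M \<in> \<C>" and "\<And>I. I \<in> \<C> \<Longrightarrow> M \<subseteq> I \<Longrightarrow> I = M"
proof -
  have "\<exists>M\<in>\<C>. \<forall>X\<in>\<C>. M \<subseteq> X \<longrightarrow> X = M"
  proof (rule subset_Zorn_nonempty[OF assms(2)])
    fix C assume "C \<noteq> {}" "subset.chain \<C> C"
    then show "\<Union>C \<in> \<C>"
      using noetherian_Union_chain[OF assms(1), of C] assms(3) unfolding pred_on.chain_def by blast
  qed
  then show ?thesis using that by blast
qed

text \<open>Coefficients are indexed by \<open>k\<close> and not by elements of the image, since
  \<open>i\<close> may repeat values; in \<open>integral_dvd\<close> the index becomes an
  exponent.\<close>

lemma span_image_atMost:
  assumes "z \<in> self.span (i ` {..n::nat})"
  shows "\<exists>u. z = (\<Sum>k\<le>n. u k * i k)"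
  using assms
proof (induction rule: self.span_induct_alt)
  case base
  show ?case by (rule exI[of _ "\<lambda>_. 0"]) simp
next
  case (step c x y)
  then obtain k u where k: "k \<le> n" "x = i k" and y: "y = (\<Sum>k\<le>n. u k * i k)" by auto
  have "(\<Sum>j\<le>n. (u j + (if j = k then c else 0)) * i j)
      = (\<Sum>j\<le>n. u j * i j) + (\<Sum>j\<le>n. if j = k then c * i k else 0)"
    unfolding sum.distrib[symmetric] by (rule sum.cong) (auto simp: distrib_right)
  then have "c * x + y = (\<Sum>j\<le>n. (u j + (if j = k then c else 0)) * i j)"
    using k y by simp
  then show ?case by (rule exI[of _ "\<lambda>j. u j + (if j = k then c else 0)"])
qed

text \<open>The fraction \<open>q = b / c\<close> maps \<open>I\<close> into itself, so every
  \<open>q ^ n * w\<close> comes from the ring. The ideals spanned by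
  \<open>w, q * w, ..., q ^ n * w\<close> stabilise; this yields a monic equation for
  \<open>q\<close> without determinants, and integral closedness puts \<open>q\<close> into the
  ring.\<close>

lemma integral_dvd:
  fixes b c :: "'a::idom"
  assumes noeth: "noetherian_ring (class_ring :: 'a ring)"
    and ic: "integrally_closed_domain TYPE('a)"
    and c: "c \<noteq> 0" and w: "w \<in> I" "w \<noteq> 0"
    and sub: "\<And>x. x \<in> I \<Longrightarrow> \<exists>y\<in>I. b * x = c * y"
  shows "c dvd b"
proof -
  define q where "q = to_fract b / to_fract c"
  have step: "\<exists>y\<in>I. to_fract y = q * to_fract x" if x: "x \<in> I" for x
  proof -
    obtain y where y: "y \<in> I" "b * x = c * y" using sub[OF x] by blast
    then have "to_fract b * to_fract x = to_fract c * to_fract y"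
      by (metis to_fract_mult)
    then have "to_fract y = q * to_fract x" using c by (simp add: q_def field_simps)
    with y show ?thesis by blast
  qed
  have "\<exists>y\<in>I. to_fract y = q ^ n * to_fract w" for n
  proof (induction n)
    case (Suc n)
    then show ?case using step by (metis mult.assoc power_Suc)
  qed (use w in auto)
  \<comment> \<open>\<open>i n\<close> is the ring element that represents
    \<open>q ^ n * w\<close>.\<close>
  then obtain i where i: "\<And>n. to_fract (i n) = q ^ n * to_fract w" by metis
  define C where "C = range (\<lambda>n. self.span (i ` {..n}))"
  have chain: "self.span (i ` {..m}) \<subseteq> self.span (i ` {..n})" if "m \<le> n" for m n
    using that by (intro self.span_mono image_mono) auto
  have "\<Union>C \<in> C"
  proof (rule noetherian_Union_chain[OF noeth])
    fix I J assume "I \<in> C" "J \<in> C"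
    then obtain m n where "I = self.span (i ` {..m})" "J = self.span (i ` {..n})"
      by (auto simp: C_def)
    then show "I \<subseteq> J \<or> J \<subseteq> I" using chain[of m n] chain[of n m] by (cases "m \<le> n") auto
  qed (auto simp: C_def)
  then obtain n where n: "\<Union>C = self.span (i ` {..n})" by (auto simp: C_def)
  have "i (Suc n) \<in> self.span (i ` {..Suc n})" by (rule self.span_base) auto
  then have "i (Suc n) \<in> self.span (i ` {..n})" unfolding n[symmetric] C_def by blast
  then obtain u where "i (Suc n) = (\<Sum>k\<le>n. u k * i k)" using span_image_atMost by blast
  then have "to_fract (i (Suc n)) = (\<Sum>k\<le>n. to_fract (u k) * to_fract (i k))"
    by simp
  then have "q ^ Suc n * to_fract w = (\<Sum>k\<le>n. to_fract (u k) * q ^ k) * to_fract w"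
    by (simp only: i sum_distrib_right mult.assoc)
  then have q: "q ^ Suc n = (\<Sum>k\<le>n. to_fract (u k) * q ^ k)" using w by simp
  \<comment> \<open>\<open>r\<close> collects the terms of degree at most \<open>n\<close>, so that
    \<open>p\<close> is monic of degree \<open>Suc n\<close> with root \<open>q\<close>.\<close>
  define r where "r = (\<Sum>k\<le>n. monom (u k) k)"
  define p where "p = monom 1 (Suc n) - r"
  have "degree r \<le> n" unfolding r_def
    by (rule degree_sum_le) (auto intro: order.trans[OF degree_monom_le])
  then have "degree r < degree (monom (1::'a) (Suc n))" by (simp add: degree_monom_eq)
  then have deg: "degree p = Suc n" and lead: "lead_coeff p = 1"
    unfolding p_def using degree_add_eq_left[of "- r" "monom 1 (Suc n)"]
      lead_coeff_add_le[of "- r" "monom 1 (Suc n)"]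
    by (simp_all add: degree_monom_eq coeff_eq_0)
  have "poly (map_poly to_fract p) q = 0"
  proof -
    have "poly (map_poly to_fract r) q = (\<Sum>k\<le>n. to_fract (u k) * q ^ k)"
    proof -
      have "map_poly to_fract r = (\<Sum>k\<le>n. monom (to_fract (u k)) k)"
        unfolding r_def by (rule poly_eqI) (simp add: coeff_map_poly coeff_sum if_distrib cong: if_cong)
      then show ?thesis by (simp add: poly_sum poly_monom)
    qed
    moreover have "map_poly to_fract p = monom 1 (Suc n) - map_poly to_fract r"
      unfolding p_def by (rule poly_eqI) (simp add: coeff_map_poly)
    ultimately show ?thesis using q by (simp add: poly_monom)
  qed
  then obtain t where "q = to_fract t"
    using ic lead unfolding integrally_closed_domain_def by blast
  then have "to_fract b = to_fract (c * t)" using c by (simp add: q_def field_simps)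
  then have "b = c * t" by (simp only: to_fract_eq_iff)
  then show ?thesis by (rule dvdI)
qed

text \<open>The ideal quotient \<open>(c D : I)\<close>. For nonzero \<open>c\<close> in
  \<open>I\<close> it is \<open>c\<close> times the fractional inverse of \<open>I\<close>, so that
  invertibility can be stated inside the ring.\<close>

definition colon :: "'a::comm_ring_1 \<Rightarrow> 'a set \<Rightarrow> 'a set" where
  "colon c I = {b. \<forall>x\<in>I. c dvd b * x}"

lemma subspace_colon: "self.subspace (colon c I)"
proof (rule self.subspaceI)
  fix a b assume "b \<in> colon c I"
  then have "c dvd a * (b * x)" if "x \<in> I" for x
    using that by (intro dvd_mult[of c "b * x"]) (auto simp: colon_def)
  then show "a * b \<in> colon c I" by (simp add: colon_def mult.assoc)
qed (auto simp: colon_def distrib_right)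

lemma colon_singleton: "x \<in> colon a {b} \<longleftrightarrow> a dvd x * b"
  by (simp add: colon_def)

lemma colon_subset_mult: "colon a {b} \<subseteq> colon a {s * b}"
proof
  fix x assume "x \<in> colon a {b}"
  then have "a dvd s * (x * b)" unfolding colon_singleton by (rule dvd_mult)
  then show "x \<in> colon a {s * b}" by (simp add: colon_singleton ac_simps)
qed

text \<open>A maximal \<open>(a : b)\<close> inside \<open>P\<close> is prime, hence maximal, hence all of \<open>P\<close>.\<close>

lemma prime_eq_colon:
  fixes a :: "'a::idom"
  assumes D: "dedekind_domain TYPE('a)"
    and P: "primeideal P (class_ring :: 'a ring)" and a: "a \<in> P" "a \<noteq> 0"
  obtains b where "P = colon a {b}"
proof -
  interpret P: primeideal P "class_ring :: 'a ring" by (fact P)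
  have noeth: "noetherian_ring (class_ring :: 'a ring)"
    using D by (simp add: dedekind_domain_def noetherian_domain_def)
  have sP: "self.subspace P" using P.ideal_axioms ideal_class_ring_iff by blast
  define \<C> where "\<C> = {C. C \<subseteq> P \<and> (\<exists>b. C = colon a {b})}"
  have "colon a {1} \<subseteq> P"
    using self.subspace_scale[OF sP a(1)] by (auto simp: colon_singleton dvd_def mult.commute)
  then have "\<C> \<noteq> {}" unfolding \<C>_def by blast
  then obtain M where "M \<in> \<C>" and M: "\<And>C. C \<in> \<C> \<Longrightarrow> M \<subseteq> C \<Longrightarrow> C = M"
    by (rule noetherian_maximal[OF noeth]) (auto simp: subspace_colon \<C>_def)
  then obtain b where sub: "colon a {b} \<subseteq> P" and "M = colon a {b}"
    by (auto simp: \<C>_def)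
  with M have mx: "colon a {b'} \<subseteq> P \<Longrightarrow> colon a {b} \<subseteq> colon a {b'} \<Longrightarrow> colon a {b'} = colon a {b}" for b'
    by (auto simp: \<C>_def)
  have "1 \<notin> P" using P.one_imp_carrier P.I_notcarr by auto
  have "primeideal (colon a {b}) (class_ring :: 'a ring)"
  proof (rule primeidealI)
    show "ideal (colon a {b}) (class_ring :: 'a ring)"
      by (simp add: ideal_class_ring_iff subspace_colon)
    show "cring (class_ring :: 'a ring)" by (rule class_cring.is_cring)
    show "carrier (class_ring :: 'a ring) \<noteq> colon a {b}" using sub \<open>1 \<notin> P\<close> by auto
    fix r s :: 'a assume "r \<otimes>\<^bsub>class_ring\<^esub> s \<in> colon a {b}"
    then have rs: "a dvd r * s * b" by (simp add: colon_singleton)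
    show "r \<in> colon a {b} \<or> s \<in> colon a {b}"
    \<comment> \<open>If \<open>(a : s b)\<close> stays inside \<open>P\<close>, maximality
      identifies it with \<open>(a : b)\<close>, and it contains \<open>r\<close>. Otherwise some
      \<open>t\<close> outside \<open>P\<close> satisfies \<open>a dvd t * s * b\<close>; primality
      of \<open>P\<close> keeps \<open>(a : t b)\<close> inside \<open>P\<close>, so it equals
      \<open>(a : b)\<close>, and it contains \<open>s\<close>.\<close>
    proof (cases "colon a {s * b} \<subseteq> P")
      case True
      have "colon a {b} \<subseteq> colon a {s * b}"
        by (rule colon_subset_mult)
      then have "colon a {s * b} = colon a {b}" using mx True by blast
      moreover have "r \<in> colon a {s * b}" using rs by (simp add: colon_singleton mult.assoc)
      ultimately show ?thesis by simp
    next
      case False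
      then obtain t where "t \<notin> P" "t \<in> colon a {s * b}" by blast
      then have t: "t \<notin> P" "a dvd t * (s * b)" by (simp_all add: colon_singleton)
      have "colon a {t * b} \<subseteq> P"
      proof
        fix x assume "x \<in> colon a {t * b}"
        then have "x * t \<in> P" using sub by (auto simp: colon_singleton mult.assoc)
        then show "x \<in> P" using P.I_prime t by auto
      qed
      moreover have "colon a {b} \<subseteq> colon a {t * b}"
        by (rule colon_subset_mult)
      ultimately have "colon a {t * b} = colon a {b}" using mx by blast
      moreover have "s \<in> colon a {t * b}" using t by (simp add: colon_singleton ac_simps)
      ultimately show ?thesis by simp
    qed
  qed
  \<comment> \<open>The element \<open>a\<close> lies in \<open>(a : b)\<close>, so this prime is
    nonzero and the Dedekind condition applies.\<close>
  moreover have "colon a {b} \<noteq> {0}" using a by (force simp: colon_singleton)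
  ultimately have "maximalideal (colon a {b}) (class_ring :: 'a ring)"
    using D unfolding dedekind_domain_def by blast
  then have "P = colon a {b}"
    using maximalideal.I_maximal[OF _ P.ideal_axioms sub] P.I_notcarr by auto
  then show ?thesis by (rule that)
qed

lemma ideal_le_prime:
  assumes noeth: "noetherian_ring (class_ring :: 'a::comm_ring_1 ring)"
    and J: "self.subspace (J :: 'a set)" "1 \<notin> J"
  obtains P where "primeideal P (class_ring :: 'a ring)" "J \<subseteq> P"
proof -
  have "{I. self.subspace I \<and> J \<subseteq> I \<and> 1 \<notin> I} \<noteq> {}" using J by blast
  then obtain P where P: "self.subspace P" "J \<subseteq> P" "1 \<notin> P"
    and mx: "\<And>I. self.subspace I \<Longrightarrow> J \<subseteq> I \<Longrightarrow> 1 \<notin> I \<Longrightarrow> P \<subseteq> I \<Longrightarrow> I = P"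
    by (rule noetherian_maximal[OF noeth]) auto
  have "maximalideal P (class_ring :: 'a ring)"
  proof (rule maximalidealI)
    fix I assume I: "ideal I (class_ring :: 'a ring)" and "P \<subseteq> I"
    then have "1 \<notin> I \<Longrightarrow> I = P"
      using mx[of I] P by (auto simp: ideal_class_ring_iff)
    then show "I = P \<or> I = carrier (class_ring :: 'a ring)"
      using ideal.one_imp_carrier[OF I] by auto
  qed (use P in \<open>auto simp: ideal_class_ring_iff\<close>)
  then have "primeideal P (class_ring :: 'a ring)"
    by (rule cring.maximalideal_prime[OF class_cring.is_cring])
  with P show ?thesis by (intro that)
qed

text \<open>With \<open>(a : I)\<close> for \<open>colon a I\<close>: if \<open>J = a\<inverse> I (a : I)\<close> were proper, it would lie in a prime
  \<open>P = (a : b)\<close>; then \<open>b (a : I) \<subseteq> a (a : I)\<close>, so \<open>b / a\<close> is integral, whence \<open>1 \<in> P\<close>.\<close>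

lemma ideal_invertible:
  fixes a :: "'a::idom"
  assumes D: "dedekind_domain TYPE('a)"
    and I: "self.subspace I" and a: "a \<in> I" "a \<noteq> 0"
  shows "a \<in> self.span {x * b | x b. x \<in> I \<and> b \<in> colon a I}" (is "_ \<in> self.span ?G")
proof (rule ccontr)
  have noeth: "noetherian_ring (class_ring :: 'a ring)" and ic: "integrally_closed_domain TYPE('a)"
    using D by (simp_all add: dedekind_domain_def noetherian_domain_def)
  define J where "J = {r. a * r \<in> self.span ?G}"
  assume "a \<notin> self.span ?G"
  then have "1 \<notin> J" by (simp add: J_def)
  moreover have "self.subspace J"
    by (rule self.subspaceI)
      (simp_all only: J_def mem_Collect_eq mult_zero_right distrib_left mult.left_commute[of a]
        self.span_zero self.span_add self.span_scale)
  ultimately obtain P where P: "primeideal P (class_ring :: 'a ring)" "J \<subseteq> P"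
    using ideal_le_prime[OF noeth] by blast
  have aI: "a \<in> colon a I" by (simp add: colon_def)
  then have "a \<in> J" using a unfolding J_def by (auto intro!: self.span_base)
  with P a prime_eq_colon[OF D P(1)] obtain b where b: "P = colon a {b}" by blast
  have "a dvd b"
  \<comment> \<open>The set that \<open>b / a\<close> maps into itself is \<open>colon a I\<close>,
    with \<open>a\<close> as a nonzero element.\<close>
  proof (rule integral_dvd[OF noeth ic a(2) aI a(2)])
    fix u assume u: "u \<in> colon a I"
    \<comment> \<open>Write \<open>u * x = a * r\<close>; then \<open>r\<close> lies in
      \<open>J\<close>, hence in \<open>P = (a : b)\<close>, which supplies the second factor
      \<open>a\<close>.\<close>
    have sp: "b * u * x \<in> {z. \<exists>t. z = a * a * t}" if x: "x \<in> I" for x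
    proof -
      obtain r where r: "u * x = a * r" using u x by (auto simp: colon_def dvd_def)
      have "a * r \<in> self.span ?G" using u x r[symmetric]
        by (intro self.span_base) (auto simp: mult.commute[of u])
      then have "r \<in> colon a {b}" using P(2) b by (auto simp: J_def)
      then obtain t where "r * b = a * t" by (auto simp: colon_singleton dvd_def)
      then have "b * u * x = a * a * t" using r by (metis mult.assoc mult.commute)
      then show ?thesis by blast
    qed
    \<comment> \<open>Taking \<open>x = a\<close> produces the quotient
      \<open>t = b * u / a\<close>; the other \<open>x\<close> then show that \<open>t\<close> lies
      in \<open>colon a I\<close>.\<close>
    obtain t where "b * u * a = a * a * t" using sp[OF a(1)] by blast
    then have y: "b * u = a * t" using a by (simp add: ac_simps)
    have "t \<in> colon a I"
      using sp a unfolding y colon_def by (fastforce simp: ac_simps)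
    with y show "\<exists>y\<in>colon a I. b * u = a * y" by blast
  qed
  then have "1 \<in> P" by (simp add: b colon_singleton)
  then show False
    using ideal.one_imp_carrier[of P "class_ring :: 'a ring"] primeideal.I_notcarr[OF P(1)]
      primeideal.axioms(1)[OF P(1)] by auto
qed

section \<open>Direct summands and functionals\<close>

locale domain_module = Modules.module scale
  for scale :: "'a::idom \<Rightarrow> 'b::ab_group_add \<Rightarrow> 'b"
begin

section \<open>Internal direct sums and inheritance by summands\<close>

lemma subspace_set_plus:
  assumes "subspace A" "subspace B"
  shows "subspace {a + b | a b. a \<in> A \<and> b \<in> B}"
proof -
  have "span (A \<union> B) = {a + b | a b. a \<in> A \<and> b \<in> B}"
    using assms by (simp add: span_Un span_eq_iff[THEN iffD2])
  then show ?thesis by (metis subspace_span)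
qed

lemma internal_direct_sumI:
  assumes "subspace A" "subspace B"
    and "\<And>a b. a \<in> A \<Longrightarrow> b \<in> B \<Longrightarrow> a + b \<in> N"
    and "\<And>x. x \<in> N \<Longrightarrow> \<exists>a\<in>A. \<exists>b\<in>B. x = a + b"
    and "\<And>x. x \<in> A \<Longrightarrow> x \<in> B \<Longrightarrow> x = 0"
  shows "internal_direct_sum scale N A B"
proof -
  have "A \<inter> B = {0}" using assms(5) subspace_0[OF assms(1)] subspace_0[OF assms(2)] by blast
  moreover have "N = {a + b | a b. a \<in> A \<and> b \<in> B}" using assms(3,4) by blast
  ultimately show ?thesis using assms(1,2) by (simp add: internal_direct_sum_def)
qed

lemma internal_direct_sumD:
  assumes "internal_direct_sum scale N A B"
  shows "subspace A" "subspace B" "subspace N" "A \<subseteq> N" "B \<subseteq> N"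
    and "x \<in> N \<Longrightarrow> \<exists>a\<in>A. \<exists>b\<in>B. x = a + b"
    and "x \<in> A \<Longrightarrow> x \<in> B \<Longrightarrow> x = 0"
proof -
  show AB: "subspace A" "subspace B"
    using assms by (simp_all add: internal_direct_sum_def)
  have N: "N = {a + b | a b. a \<in> A \<and> b \<in> B}" and 0: "A \<inter> B = {0}"
    using assms by (simp_all add: internal_direct_sum_def)
  show "subspace N" unfolding N using AB by (rule subspace_set_plus)
  show "A \<subseteq> N" unfolding N using subspace_0[OF AB(2)] by force
  show "B \<subseteq> N" unfolding N using subspace_0[OF AB(1)] by force
  show "x \<in> N \<Longrightarrow> \<exists>a\<in>A. \<exists>b\<in>B. x = a + b" unfolding N by blast
  show "x \<in> A \<Longrightarrow> x \<in> B \<Longrightarrow> x = 0" using 0 by blast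
qed

lemma internal_direct_sum_commute:
  assumes "internal_direct_sum scale N A B"
  shows "internal_direct_sum scale N B A"
proof (rule internal_direct_sumI)
  note D = internal_direct_sumD[OF assms]
  show "subspace A" "subspace B" by (fact D)+
  fix b a assume "b \<in> B" "a \<in> A"
  then show "b + a \<in> N" using D(4,5) subspace_add[OF D(3)] by blast
next
  note D = internal_direct_sumD[OF assms]
  show "\<exists>b\<in>B. \<exists>a\<in>A. x = b + a" if "x \<in> N" for x
    using D(6)[OF that] by (metis add.commute)
  show "x = 0" if "x \<in> B" "x \<in> A" for x using D(7) that by blast
qed

lemma internal_direct_sum_assoc:
  assumes 1: "internal_direct_sum scale N P C" and 2: "internal_direct_sum scale P A B"
  shows "internal_direct_sum scale N A {b + c | b c. b \<in> B \<and> c \<in> C}"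
proof (rule internal_direct_sumI)
  note D = internal_direct_sumD[OF 1] and E = internal_direct_sumD[OF 2]
  show "subspace A" by (fact E)
  show "subspace {b + c | b c. b \<in> B \<and> c \<in> C}" using E(2) D(2) by (rule subspace_set_plus)
  show "a + x \<in> N" if ax: "a \<in> A" "x \<in> {b + c | b c. b \<in> B \<and> c \<in> C}" for a x
  proof -
    obtain b c where b: "b \<in> B" "c \<in> C" "x = b + c" using ax by blast
    then have "a \<in> N" "b \<in> N" "c \<in> N" using ax(1) D(4,5) E(4,5) by auto
    then show ?thesis using b(3) subspace_add[OF D(3)] by simp
  qed
  show "\<exists>a\<in>A. \<exists>y\<in>{b + c | b c. b \<in> B \<and> c \<in> C}. x = a + y" if x: "x \<in> N" for x
  proof -
    obtain p c where p: "p \<in> P" "c \<in> C" "x = p + c" using D(6)[OF x] by blast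
    obtain a b where "a \<in> A" "b \<in> B" "p = a + b" using E(6)[OF p(1)] by blast
    then have "x = a + (b + c)" using p by (simp add: add.assoc)
    with \<open>a \<in> A\<close> \<open>b \<in> B\<close> \<open>c \<in> C\<close> show ?thesis by blast
  qed
  show "x = 0" if x: "x \<in> A" "x \<in> {b + c | b c. b \<in> B \<and> c \<in> C}" for x
  proof -
    obtain b c where b: "b \<in> B" "c \<in> C" "x = b + c" using x by blast
    have "x \<in> P" "b \<in> P" using x b E(4,5) by auto
    then have "x - b \<in> P" by (rule subspace_diff[OF E(3)])
    then have "c = 0" using D(7)[of c] b by simp
    then show ?thesis using E(7)[of x] x b by simp
  qed
qed

lemma direct_summand_trans:
  assumes "direct_summand scale N B" "direct_summand scale B A"
  shows "direct_summand scale N A"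
  using assms internal_direct_sum_assoc unfolding direct_summand_def by blast

text \<open>The modular law: if \<open>C\<close> complements \<open>A\<close> in \<open>N\<close>,
  then \<open>B \<inter> C\<close> complements \<open>A\<close> in \<open>B\<close>.\<close>

lemma direct_summand_restrict:
  assumes A: "direct_summand scale N A" "A \<subseteq> B" and B: "subspace B" "B \<subseteq> N"
  shows "direct_summand scale B A"
proof -
  obtain C where "internal_direct_sum scale N A C" using A by (auto simp: direct_summand_def)
  note D = internal_direct_sumD[OF this]
  have "internal_direct_sum scale B A (B \<inter> C)"
  proof (rule internal_direct_sumI)
    show "subspace A" by (fact D)
    show "subspace (B \<inter> C)" using B(1) D(2) by (rule subspace_inter)
    show "\<exists>a\<in>A. \<exists>c\<in>B \<inter> C. x = a + c" if x: "x \<in> B" for x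
    proof -
      obtain a c where a: "a \<in> A" "c \<in> C" "x = a + c" using D(6) x B by blast
      then have "x - a \<in> B" using subspace_diff[OF B(1)] x A by blast
      then show ?thesis using a by auto
    qed
  qed (use D A B subspace_add in auto)
  then show ?thesis by (auto simp: direct_summand_def)
qed

text \<open>For \<open>N = P \<oplus> Q\<close> and \<open>P = A \<oplus> B\<close>, a map from
  \<open>A\<close> to \<open>B\<close> is also a map into \<open>B \<oplus> Q\<close>, which
  complements \<open>A\<close> in \<open>N\<close>. A summand of \<open>B \<oplus> Q\<close> inside
  \<open>B\<close> is a summand of \<open>B\<close>.\<close>

lemma C4_module_summand:
  assumes C4: "C4_module scale N" and P: "direct_summand scale N P"
  shows "C4_module scale P"
  unfolding C4_module_def
proof (intro allI impI, elim conjE)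
  fix A B f
  assume AB: "internal_direct_sum scale P A B" and f: "submodule_hom scale A B f"
    and ker: "direct_summand scale A {x \<in> A. f x = 0}"
  obtain Q where Q: "internal_direct_sum scale N P Q" using P by (auto simp: direct_summand_def)
  let ?B = "{b + q | b q. b \<in> B \<and> q \<in> Q}"
  have B: "subspace B" "subspace Q" using AB Q by (auto dest: internal_direct_sumD)
  have sub: "B \<subseteq> ?B" using subspace_0[OF B(2)] by force
  have "submodule_hom scale A ?B f" using f sub unfolding submodule_hom_def by blast
  then have "direct_summand scale ?B (f ` A)"
    using C4 internal_direct_sum_assoc[OF Q AB] ker unfolding C4_module_def by blast
  moreover have "f ` A \<subseteq> B" using f by (auto simp: submodule_hom_def)
  ultimately show "direct_summand scale B (f ` A)"
    using B(1) sub by (rule direct_summand_restrict)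
qed

section \<open>Torsion, linear dependence and the sufficient condition for C4\<close>

abbreviation "torsion \<equiv> torsion_submodule scale"

lemma subspace_torsion: "subspace torsion"
proof (rule subspaceI)
  show "0 \<in> torsion" by (auto simp: torsion_submodule_def intro!: exI[of _ 1])
next
  fix x y assume "x \<in> torsion" "y \<in> torsion"
  then obtain d e where "d \<noteq> 0" "e \<noteq> 0" "scale d x = 0" "scale e y = 0"
    by (auto simp: torsion_submodule_def)
  moreover have "scale (d * e) (x + y) = scale e (scale d x) + scale d (scale e y)"
    by (simp add: scale_right_distrib mult.commute)
  ultimately show "x + y \<in> torsion"
    by (auto simp: torsion_submodule_def intro!: exI[of _ "d * e"])
next
  fix c x assume "x \<in> torsion"
  then obtain d where "d \<noteq> 0" "scale d x = 0" by (auto simp: torsion_submodule_def)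
  moreover have "scale d (scale c x) = scale c (scale d x)" by (rule scale_left_commute)
  ultimately show "scale c x \<in> torsion" by (auto simp: torsion_submodule_def simp del: scale_scale)
qed

text \<open>If \<open>d\<close> kills \<open>a + b\<close>, then
  \<open>scale d a = - scale d b\<close> lies in \<open>A \<inter> B\<close>, so \<open>d\<close>
  kills both components.\<close>

lemma internal_direct_sum_torsion:
  assumes "internal_direct_sum scale N A B"
  shows "internal_direct_sum scale (N \<inter> torsion) (A \<inter> torsion) (B \<inter> torsion)"
proof (rule internal_direct_sumI)
  note D = internal_direct_sumD[OF assms]
  show "subspace (A \<inter> torsion)" "subspace (B \<inter> torsion)"
    using D subspace_torsion by (auto intro: subspace_inter)
  show "a + b \<in> N \<inter> torsion" if "a \<in> A \<inter> torsion" "b \<in> B \<inter> torsion" for a b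
    using that D(4,5) subspace_add[OF D(3), of a b] subspace_add[OF subspace_torsion, of a b] by auto
  show "\<exists>a\<in>A \<inter> torsion. \<exists>b\<in>B \<inter> torsion. x = a + b" if x: "x \<in> N \<inter> torsion" for x
  proof -
    obtain a b where ab: "a \<in> A" "b \<in> B" "x = a + b" using D(6) x by blast
    obtain d where d: "d \<noteq> 0" "scale d x = 0" using x by (auto simp: torsion_submodule_def)
    have s: "scale d a + scale d b = 0" using d ab by (simp add: scale_right_distrib)
    then have "scale d a = - scale d b" by (simp add: eq_neg_iff_add_eq_0)
    then have "scale d a \<in> B" using ab D(2) subspace_neg subspace_scale by metis
    then have "scale d a = 0" using ab D(1,7) subspace_scale by blast
    with s have "scale d a = 0" "scale d b = 0" by simp_all
    with d ab show ?thesis by (auto simp: torsion_submodule_def)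
  qed
qed (use internal_direct_sumD[OF assms] in blast)

text \<open>A tensor-free form of rank at most one: any two elements are linearly dependent. For
  finitely generated modules it is matched with \<open>module_rank\<close> below.\<close>

definition rank_le_one :: bool where
  "rank_le_one \<longleftrightarrow> (\<forall>x y. \<exists>d e. (d \<noteq> 0 \<or> e \<noteq> 0) \<and> scale d x + scale e y = 0)"

lemma C4_module_if_torsion:
  assumes rank: rank_le_one and C4: "C4_module scale torsion"
    and summand: "direct_summand scale UNIV torsion"
  shows "C4_module scale UNIV"
  unfolding C4_module_def
proof (intro allI impI, elim conjE)
  fix A B f
  assume AB: "internal_direct_sum scale UNIV A B" and f: "submodule_hom scale A B f"
    and ker: "direct_summand scale A {x \<in> A. f x = 0}"
  note D = internal_direct_sumD[OF AB]
  have f_in: "f x \<in> B" and f_add: "y \<in> A \<Longrightarrow> f (x + y) = f x + f y"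
    and f_scale: "f (scale r x) = scale r (f x)" if "x \<in> A" for x y r
    using f that by (auto simp: submodule_hom_def)
  let ?K = "{x \<in> A. f x = 0}"
  obtain L where L: "internal_direct_sum scale A ?K L" using ker by (auto simp: direct_summand_def)
  note E = internal_direct_sumD[OF L]
  have tor: "internal_direct_sum scale torsion (A \<inter> torsion) (B \<inter> torsion)"
    using internal_direct_sum_torsion[OF AB] by simp
  have "f x \<in> torsion" if "x \<in> A" "x \<in> torsion" for x
  proof -
    obtain d where "d \<noteq> 0" "scale d x = 0" using \<open>x \<in> torsion\<close> by (auto simp: torsion_submodule_def)
    moreover have "f 0 = 0" using f_scale[OF \<open>x \<in> A\<close>, of 0] by simp
    ultimately show ?thesis using f_scale[OF \<open>x \<in> A\<close>, of d] by (auto simp: torsion_submodule_def)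
  qed
  then have "submodule_hom scale (A \<inter> torsion) (B \<inter> torsion) f"
    using f_in f_add f_scale by (auto simp: submodule_hom_def)
  moreover have "direct_summand scale (A \<inter> torsion) {x \<in> A \<inter> torsion. f x = 0}"
  proof -
    have "?K \<inter> torsion = {x \<in> A \<inter> torsion. f x = 0}" by blast
    with internal_direct_sum_torsion[OF L] show ?thesis by (auto simp: direct_summand_def)
  qed
  ultimately have im: "direct_summand scale (B \<inter> torsion) (f ` (A \<inter> torsion))"
    using C4 tor unfolding C4_module_def by blast
  \<comment> \<open>A dependence between \<open>x\<close> in \<open>L\<close> and \<open>f x\<close>
    in \<open>B\<close> splits: \<open>scale d x = 0\<close> because \<open>A\<close> meets
    \<open>B\<close> trivially, and then \<open>scale e x = 0\<close> because it lies in both the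
    kernel and \<open>L\<close>.\<close>
  have "L \<subseteq> torsion"
  proof
    fix x assume x: "x \<in> L"
    then have xA: "x \<in> A" using E(5) by blast
    obtain d e where de: "d \<noteq> 0 \<or> e \<noteq> 0" "scale d x + scale e (f x) = 0"
      using rank unfolding rank_le_one_def by blast
    have "scale d x = - scale e (f x)" using de(2) by (simp add: eq_neg_iff_add_eq_0)
    then have "scale d x \<in> B"
      using f_in[OF xA] subspace_neg[OF D(2)] subspace_scale[OF D(2)] by simp
    then have dx: "scale d x = 0" using D(7) subspace_scale[OF D(1) xA] by blast
    then have "f (scale e x) = 0" using de(2) f_scale[OF xA] by simp
    then have "scale e x = 0"
      using E(7) subspace_scale[OF E(2) x] subspace_scale[OF D(1) xA] by blast
    with dx de(1) show "x \<in> torsion" by (auto simp: torsion_submodule_def)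
  qed
  have "f ` A = f ` (A \<inter> torsion)"
  proof (intro subset_antisym subsetI)
    fix y assume "y \<in> f ` A"
    then obtain x where x: "x \<in> A" "y = f x" by blast
    then obtain k l where kl: "k \<in> ?K" "l \<in> L" "x = k + l" using E(6) by blast
    then have "l \<in> A \<inter> torsion" using E(5) \<open>L \<subseteq> torsion\<close> by blast
    moreover have "y = f l" using x kl f_add[of k l] \<open>l \<in> A \<inter> torsion\<close> by simp
    ultimately show "y \<in> f ` (A \<inter> torsion)" by blast
  qed auto
  moreover have "direct_summand scale B (B \<inter> torsion)"
  proof -
    have "direct_summand scale torsion (B \<inter> torsion)"
      using internal_direct_sum_commute[OF tor] by (auto simp: direct_summand_def)
    with summand have "direct_summand scale UNIV (B \<inter> torsion)" by (rule direct_summand_trans)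
    then show ?thesis by (rule direct_summand_restrict) (use D(2) in auto)
  qed
  ultimately show "direct_summand scale B (f ` A)"
    using im direct_summand_trans by simp
qed

text \<open>If a functional \<open>\<phi>\<close> has image \<open>I\<close> and \<open>a = \<Sum> x\<^sub>i b\<^sub>i\<close> with \<open>x\<^sub>i = \<phi> m\<^sub>i\<close> and \<open>b\<^sub>i I \<subseteq> a D\<close>, then
  \<open>\<Sum> (b\<^sub>i \<phi> / a) m\<^sub>i\<close> is an idempotent with the same kernel as \<open>\<phi>\<close>.\<close>

lemma functional_splits:
  assumes D: "dedekind_domain TYPE('a)"
    and \<phi>: "Modules.module_hom scale (*) \<phi>" and nz: "\<phi> v \<noteq> 0"
  obtains \<pi> where "Modules.module_hom scale scale \<pi>" "\<And>m. \<phi> (\<pi> m) = \<phi> m" "\<And>m. \<phi> m = 0 \<Longrightarrow> \<pi> m = 0"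
proof -
  interpret \<phi>: Modules.module_hom scale "(*)" \<phi> by (fact \<phi>)
  define I where "I = range \<phi>"
  define a where "a = \<phi> v"
  have I: "self.subspace I" unfolding I_def using subspace_UNIV by (rule \<phi>.subspace_image)
  have a: "a \<in> I" "a \<noteq> 0" using nz by (auto simp: I_def a_def)
  \<comment> \<open>The induction over the span needs all \<open>t\<close>: \<open>p\<close>
    satisfies \<open>\<phi> p = (t / a) \<phi>\<close> with the denominator cleared. The case
    \<open>t = a\<close> is the splitting.\<close>
  have "\<exists>p. Modules.module_hom scale scale p \<and> (\<forall>m. a * \<phi> (p m) = t * \<phi> m) \<and> (\<forall>m. \<phi> m = 0 \<longrightarrow> p m = 0)"
    if "t \<in> self.span {x * b | x b. x \<in> I \<and> b \<in> colon a I}" for t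
    using that
  proof (induction rule: self.span_induct_alt)
    case base
    show ?case
      by (rule exI[of _ "\<lambda>_. 0"])
        (auto intro!: module_pair.module_hom_zero simp: module_pair_def module_axioms)
  next
    case (step c x y)
    then obtain m b where b: "x = \<phi> m * b" "b \<in> colon a I" by (auto simp: I_def)
    obtain p where p: "Modules.module_hom scale scale p"
      and p': "\<And>n. a * \<phi> (p n) = y * \<phi> n" "\<And>n. \<phi> n = 0 \<Longrightarrow> p n = 0"
      using step by blast
    interpret p: Modules.module_hom scale scale p by (fact p)
    have "\<exists>k. b * \<phi> n = a * k" for n using b by (auto simp: colon_def I_def dvd_def)
    then obtain k where k: "\<And>n. b * \<phi> n = a * k n" by metis
    have "a * k (n + n') = a * (k n + k n')" "a * k (scale r n) = a * (r * k n)" for n n' r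
      by (simp_all add: k[symmetric] \<phi>.add \<phi>.scale algebra_simps)
    then have k_add: "k (n + n') = k n + k n'" and k_scale: "k (scale r n) = r * k n" for n n' r
      using a(2) mult_cancel_left by blast+
    \<comment> \<open>Here \<open>k\<close> is the functional \<open>b \<phi> / a\<close>; the added
      term contributes \<open>c * x / a\<close> times \<open>\<phi>\<close>.\<close>
    define p2 where "p2 n = p n + scale (c * k n) m" for n
    have "Modules.module_hom scale scale p2"
      by unfold_locales (simp_all add: p2_def p.add p.scale k_add k_scale algebra_simps)
    moreover have "a * \<phi> (p2 n) = (c * x + y) * \<phi> n" for n
    proof -
      have "a * \<phi> (p2 n) = y * \<phi> n + c * \<phi> m * (a * k n)"
        by (simp add: p2_def \<phi>.add \<phi>.scale distrib_left p' ac_simps)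
      then show ?thesis by (simp add: k[symmetric] b algebra_simps)
    qed
    moreover have "p2 n = 0" if "\<phi> n = 0" for n
    proof -
      have "k n = 0" using k[of n] that a by simp
      then show ?thesis using p' that by (simp add: p2_def)
    qed
    ultimately show ?case by blast
  qed
  from this[OF ideal_invertible[OF D I a]] show ?thesis using that a(2) by auto
qed

lemma functional_direct_sum:
  assumes \<phi>: "Modules.module_hom scale (*) \<phi>" and \<pi>: "Modules.module_hom scale scale \<pi>"
    and "\<And>m. \<phi> (\<pi> m) = \<phi> m" and "\<And>m. \<phi> m = 0 \<Longrightarrow> \<pi> m = 0"
  shows "internal_direct_sum scale UNIV (range \<pi>) {x. \<phi> x = 0}"
proof -
  interpret \<phi>: Modules.module_hom scale "(*)" \<phi> by (fact \<phi>)
  interpret \<pi>: Modules.module_hom scale scale \<pi> by (fact \<pi>)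
  show ?thesis
  proof (rule internal_direct_sumI)
    show "subspace (range \<pi>)" using subspace_UNIV by (rule \<pi>.subspace_image)
    show "subspace {x. \<phi> x = 0}" by (rule \<phi>.subspace_kernel)
    show "\<exists>a\<in>range \<pi>. \<exists>b\<in>{x. \<phi> x = 0}. x = a + b" for x
      using assms(3)[of x] by (intro bexI[of _ "\<pi> x"] bexI[of _ "x - \<pi> x"]) (auto simp: \<phi>.diff)
  qed (use assms in auto)
qed

text \<open>Enlarge \<open>span {y}\<close> by generators to a \<open>W\<close> that is maximal
  among those containing no nonzero multiple of \<open>x\<close>. Modulo \<open>W\<close> every
  element is proportional to \<open>x\<close> up to a nonzero factor, and finite generation gives a
  common factor \<open>d\<close>. Then \<open>\<phi> z\<close> is the unique \<open>e\<close> with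
  \<open>scale d z\<close> congruent to \<open>scale e x\<close>; in particular
  \<open>\<phi> x = d\<close>.\<close>

lemma functional_exists:
  assumes fg: "finite S" "span S = UNIV" and indep: "\<And>d e. d \<noteq> 0 \<Longrightarrow> scale d x \<noteq> scale e y"
  obtains \<phi> where "Modules.module_hom scale (*) \<phi>" "\<phi> x \<noteq> 0" "\<phi> y = 0"
proof -
  define Q where "Q T \<longleftrightarrow> (\<forall>d. d \<noteq> 0 \<longrightarrow> scale d x \<notin> span (insert y T))" for T
  have "Q {}" using indep by (auto simp: Q_def span_singleton)
  then have "{T \<in> Pow S. Q T} \<noteq> {}" by blast
  then obtain T where "T \<in> {T \<in> Pow S. Q T}"
    and mx: "\<And>T'. T' \<in> {T \<in> Pow S. Q T} \<Longrightarrow> T \<subseteq> T' \<Longrightarrow> T = T'"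
    using finite_has_maximal[of "{T \<in> Pow S. Q T}"] fg(1) by auto
  then have T: "T \<subseteq> S" "Q T" by auto
  define W where "W = span (insert y T)"
  have W: "subspace W" by (simp add: W_def)
  have xW: "d = 0" if "scale d x \<in> W" for d using T(2) that by (auto simp: Q_def W_def)
  have gen: "\<exists>d e. d \<noteq> 0 \<and> scale d z - scale e x \<in> W" if z: "z \<in> S" for z
  proof (cases "z \<in> T")
    case True
    then show ?thesis
      by (intro exI[of _ 1] exI[of _ 0]) (simp add: W_def span_base)
  next
    case False
    then have "\<not> Q (insert z T)" using mx[of "insert z T"] T z by auto
    then obtain b where b: "b \<noteq> 0" "scale b x \<in> span (insert z (insert y T))"
      by (auto simp: Q_def insert_commute)
    then obtain k where k: "scale b x - scale k z \<in> W"
      unfolding W_def span_breakdown_eq[of _ z] by blast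
    then have "k \<noteq> 0" using xW[of b] b by auto
    moreover have "scale k z - scale b x \<in> W" using subspace_neg[OF W k] by simp
    ultimately show ?thesis by blast
  qed
  \<comment> \<open>A common denominator for the generators, as a product of their individual
    factors.\<close>
  have "\<exists>d. d \<noteq> 0 \<and> (\<forall>z\<in>S'. \<exists>e. scale d z - scale e x \<in> W)" if "finite S'" "S' \<subseteq> S" for S'
    using that
  proof (induction S')
    case (insert s S')
    then obtain d where d: "d \<noteq> 0" "\<forall>z\<in>S'. \<exists>e. scale d z - scale e x \<in> W" by auto
    obtain d' e' where d': "d' \<noteq> 0" "scale d' s - scale e' x \<in> W" using gen[of s] insert.prems by auto
    have mult: "\<exists>e'. scale (r * c) z - scale e' x \<in> W" if "scale c z - scale e x \<in> W" for r c e z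
      using subspace_scale[OF W that, of r] by (auto simp: scale_right_diff_distrib)
    have "\<exists>e. scale (d * d') z - scale e x \<in> W" if z: "z \<in> insert s S'" for z
    proof (cases "z = s")
      case True
      then show ?thesis using mult[OF d'(2), of d] by simp
    next
      case False
      then obtain e where "scale d z - scale e x \<in> W" using d z by blast
      then show ?thesis using mult[of d z e d'] by (simp add: mult.commute)
    qed
    then show ?case using d d' by (intro exI[of _ "d * d'"]) auto
  qed (auto intro: exI[of _ 1])
  from this[OF fg(1) order_refl]
  obtain d where d: "d \<noteq> 0" and dS: "\<forall>z\<in>S. \<exists>e. scale d z - scale e x \<in> W" by blast
  have "\<exists>e. scale d z - scale e x \<in> W" for z
  proof -
    have "z \<in> span S" using fg(2) by simp
    then show ?thesis
    proof (induction rule: span_induct_alt)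
      case base
      show ?case using subspace_0[OF W] by (intro exI[of _ 0]) simp
    next
      case (step c z w)
      obtain e e' where e: "scale d z - scale e x \<in> W" "scale d w - scale e' x \<in> W"
        using dS step by blast
      have "scale c (scale d z - scale e x) + (scale d w - scale e' x) \<in> W"
        using e subspace_add[OF W] subspace_scale[OF W] by blast
      also have "scale c (scale d z - scale e x) + (scale d w - scale e' x)
          = scale d (scale c z + w) - scale (c * e + e') x"
        by (simp add: algebra_simps)
      finally show ?case by blast
    qed
  qed
  then obtain \<phi> where \<phi>: "\<And>z. scale d z - scale (\<phi> z) x \<in> W" by metis
  have uniq: "\<phi> z = e" if "scale d z - scale e x \<in> W" for z e
  proof -
    have "scale (\<phi> z - e) x = (scale d z - scale e x) - (scale d z - scale (\<phi> z) x)"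
      by (simp add: algebra_simps)
    then have "scale (\<phi> z - e) x \<in> W" using subspace_diff[OF W that \<phi>[of z]] by simp
    then show ?thesis using xW by force
  qed
  have "Modules.module_hom scale (*) \<phi>"
  proof unfold_locales
    fix z w r
    have "scale d (z + w) - scale (\<phi> z + \<phi> w) x = (scale d z - scale (\<phi> z) x) + (scale d w - scale (\<phi> w) x)"
      by (simp add: algebra_simps)
    then show "\<phi> (z + w) = \<phi> z + \<phi> w" using \<phi> subspace_add[OF W] by (intro uniq) simp
    have "scale d (scale r z) - scale (r * \<phi> z) x = scale r (scale d z - scale (\<phi> z) x)"
      by (simp add: algebra_simps)
    then show "\<phi> (scale r z) = r * \<phi> z" using \<phi> subspace_scale[OF W] by (intro uniq) simp
  qed
  moreover have "\<phi> x = d" using subspace_0[OF W] by (intro uniq) simp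
  moreover have "\<phi> y = 0" using subspace_scale[OF W] by (intro uniq) (simp add: W_def span_base)
  ultimately show ?thesis using d that by simp
qed

end

section \<open>Rank\<close>

text \<open>On formal sums, the map induced by \<open>\<phi>\<close> from
  \<open>K \<otimes> M\<close> to \<open>K\<close>, with \<open>q \<otimes> m\<close> going to
  \<open>q * \<phi> m\<close>. For linear \<open>\<phi>\<close> it descends to cosets by
  \<open>tensor_eval_null\<close>.\<close>

definition tensor_eval :: "('b \<Rightarrow> 'a) \<Rightarrow> ('a::idom fract \<times> 'b \<Rightarrow>\<^sub>0 int) \<Rightarrow> 'a fract" where
  "tensor_eval \<phi> c = (\<Sum>p\<in>Poly_Mapping.keys c. of_int (Poly_Mapping.lookup c p) * (fst p * to_fract (\<phi> (snd p))))"

lemma tensor_eval_superset: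
  assumes "finite F" "Poly_Mapping.keys c \<subseteq> F"
  shows "tensor_eval \<phi> c = (\<Sum>p\<in>F. of_int (Poly_Mapping.lookup c p) * (fst p * to_fract (\<phi> (snd p))))"
  unfolding tensor_eval_def using assms
  by (intro sum.mono_neutral_left) (auto simp: in_keys_iff)

lemma tensor_eval_zero [simp]: "tensor_eval \<phi> 0 = 0"
  by (simp add: tensor_eval_def)

lemma tensor_eval_frag_of [simp]: "tensor_eval \<phi> (frag_of (q, m)) = q * to_fract (\<phi> m)"
  by (simp add: tensor_eval_def)

lemma tensor_eval_add [simp]: "tensor_eval \<phi> (c + d) = tensor_eval \<phi> c + tensor_eval \<phi> d"
proof -
  let ?F = "Poly_Mapping.keys c \<union> Poly_Mapping.keys d"
  have "finite ?F" "Poly_Mapping.keys (c + d) \<subseteq> ?F"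
    by (auto dest: subsetD[OF Poly_Mapping.keys_add])
  then show ?thesis
    by (simp add: tensor_eval_superset[of ?F] lookup_add distrib_right sum.distrib)
qed

lemma tensor_eval_minus [simp]: "tensor_eval \<phi> (- c) = - tensor_eval \<phi> c"
  using tensor_eval_add[of \<phi> c "- c"] by (simp add: eq_neg_iff_add_eq_0 add.commute)

lemma tensor_eval_diff [simp]: "tensor_eval \<phi> (c - d) = tensor_eval \<phi> c - tensor_eval \<phi> d"
  using tensor_eval_add[of \<phi> c "- d"] by simp

lemma tensor_eval_scale:
  "tensor_eval \<phi> (frag_extend (\<lambda>(q, m). frag_of (k * q, m)) c) = k * tensor_eval \<phi> c"
proof -
  have "Poly_Mapping.keys c \<subseteq> UNIV" by simp
  then show ?thesis
    by (induction c rule: frag_induction) (auto simp: frag_extend_diff right_diff_distrib)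
qed

section \<open>Pure tensors and the dimension of the extended module\<close>

context domain_module
begin

lemma tensor_eval_null:
  assumes \<phi>: "Modules.module_hom scale (*) \<phi>" and c: "c \<in> tensor_null fract_scale scale"
  shows "tensor_eval \<phi> c = 0"
proof -
  interpret \<phi>: Modules.module_hom scale "(*)" \<phi> by (fact \<phi>)
  have rel: "tensor_eval \<phi> h = 0" if "h \<in> tensor_relators fract_scale scale" for h
    using that unfolding tensor_relators_def
    by (elim UnE CollectE exE conjE; hypsubst) (simp_all add: \<phi>.add \<phi>.scale algebra_simps)
  show ?thesis
    using c unfolding tensor_null_def
    by (induction rule: generate.induct) (simp_all add: rel)
qed

abbreviation "tcoset \<equiv> tensor_coset fract_scale scale"

lemma tensor_null_relator:
  shows "frag_of (q, m + m') - frag_of (q, m) - frag_of (q, m') \<in> tensor_null fract_scale scale"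
    and "frag_of (to_fract d * q, m) - frag_of (q, scale d m) \<in> tensor_null fract_scale scale"
  unfolding tensor_null_def by (rule generate.incl; unfold tensor_relators_def; blast)+

lemma tcoset_add_right: "tcoset (frag_of (q, m + m')) = tcoset (frag_of (q, m) + frag_of (q, m'))"
  using tensor_null_relator(1)[of q m m'] by (simp add: tensor_coset_eq_iff algebra_simps)

lemma tcoset_balanced: "tcoset (frag_of (q, scale d m)) = tcoset (frag_of (to_fract d * q, m))"
  using tensor_null_relator(2)[of d q m] by (metis tensor_coset_eq_iff)

sublocale V: vectorspace "class_ring :: 'a fract ring" "fract_tensor scale"
  by (rule vectorspace_fract_tensor)

lemma carrier_V: "carrier (fract_tensor scale) = range tcoset"
  by (simp add: fract_tensor_def carrier_tensor_group)

lemma tcoset_add: "tcoset c \<oplus>\<^bsub>fract_tensor scale\<^esub> tcoset d = tcoset (c + d)"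
  by (simp add: fract_tensor_def mult_tensor_coset)

lemma tcoset_zero: "\<zero>\<^bsub>fract_tensor scale\<^esub> = tcoset 0"
proof -
  have "tcoset 0 \<oplus>\<^bsub>fract_tensor scale\<^esub> tcoset 0 = tcoset 0" by (simp add: tcoset_add)
  moreover have "tcoset 0 \<in> carrier (fract_tensor scale)" by (auto simp: carrier_V)
  ultimately show ?thesis by (metis V.M.add.l_cancel_one)
qed

lemma tcoset_smult: "k \<odot>\<^bsub>fract_tensor scale\<^esub> tcoset (frag_of (q, m)) = tcoset (frag_of (k * q, m))"
  by (simp add: smult_tensor_coset)

text \<open>Pure tensors generate. Since \<open>frag_induction\<close> builds formal sums by
  differences, negatives are rewritten as multiples by \<open>- 1\<close>.\<close>

lemma tcoset_in_submodule:
  assumes U: "submodule class_ring U (fract_tensor scale)"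
    and gen: "\<And>q m. tcoset (frag_of (q, m)) \<in> U"
  shows "tcoset c \<in> U"
proof -
  interpret U: submodule class_ring U "fract_tensor scale" by (fact U)
  have "Poly_Mapping.keys c \<subseteq> UNIV" by simp
  then show ?thesis
  proof (induction c rule: frag_induction)
    case zero
    then show ?case using U.zero_closed by (simp add: tcoset_zero)
  next
    case (one p)
    then show ?case using gen[of "fst p" "snd p"] by simp
  next
    case (diff c d)
    have "tcoset (- d) = \<ominus>\<^bsub>fract_tensor scale\<^esub> tcoset d"
      by (rule V.M.minus_equality[symmetric]) (auto simp: tcoset_add tcoset_zero carrier_V)
    also have "\<dots> = (- 1) \<odot>\<^bsub>fract_tensor scale\<^esub> tcoset d"
      using V.smult_l_minus[of 1 "tcoset d"] V.smult_one[of "tcoset d"]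
      by (simp add: carrier_V class_ring_simps)
    also have "\<dots> \<in> U" using diff by (intro U.smult_closed) auto
    finally have "tcoset c \<oplus>\<^bsub>fract_tensor scale\<^esub> tcoset (- d) \<in> U"
      using diff by (intro U.m_closed)
    then show ?case by (simp add: tcoset_add)
  qed
qed

text \<open>The elements \<open>1 \<otimes> s\<close> generate. The dimension is a least
  cardinality, so a bound on it yields a small generating set only once some finite one
  exists.\<close>

lemma V_fin_dim:
  assumes "finite S" "span S = UNIV"
  shows "V.fin_dim"
proof -
  let ?A = "(\<lambda>s. tcoset (frag_of (1, s))) ` S"
  have A: "?A \<subseteq> carrier (fract_tensor scale)" by (auto simp: carrier_V)
  have U: "submodule class_ring (V.span ?A) (fract_tensor scale)"
    using A by (rule V.span_is_submodule)
  interpret U: submodule class_ring "V.span ?A" "fract_tensor scale" by (fact U)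
  have "tcoset (frag_of (q, m)) \<in> V.span ?A" for q m
  proof -
    have "m \<in> span S" using assms by simp
    then show ?thesis
    proof (induction arbitrary: q rule: span_induct_alt)
      case base
      \<comment> \<open>The additivity relator at \<open>m = m' = 0\<close> is
        \<open>- frag_of (q, 0)\<close>.\<close>
      have "frag_of (q, 0) \<in> tensor_null fract_scale scale"
        using tensor_null_minus[OF tensor_null_relator(1)[of q 0 0]] by simp
      then have "tcoset (frag_of (q, 0)) = \<zero>\<^bsub>fract_tensor scale\<^esub>"
        by (simp add: tcoset_zero tensor_coset_eq_iff)
      then show ?case using U.zero_closed by simp
    next
      case (step c s w)
      have "tcoset (frag_of (1, s)) \<in> V.span ?A" using step V.in_own_span[OF A] by blast
      then have "(to_fract c * q) \<odot>\<^bsub>fract_tensor scale\<^esub> tcoset (frag_of (1, s)) \<in> V.span ?A"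
        by (intro U.smult_closed) auto
      then have "tcoset (frag_of (q, scale c s)) \<in> V.span ?A"
        by (simp add: tcoset_smult tcoset_balanced)
      then show ?case
        using step(2)[of q] by (simp add: tcoset_add_right tcoset_add[symmetric])
    qed
  qed
  then have "carrier (fract_tensor scale) \<subseteq> V.span ?A"
    using tcoset_in_submodule[OF U] by (auto simp: carrier_V)
  then have "V.gen_set ?A" using U.subset by blast
  with A assms show ?thesis unfolding V.fin_dim_def by blast
qed

text \<open>All elements are proportional to one \<open>x\<close>, taken to be nontorsion if
  possible and \<open>0\<close> otherwise. If \<open>scale d m = scale e x\<close>, then
  \<open>q \<otimes> m\<close> is \<open>e q / d\<close> times \<open>1 \<otimes> x\<close>.\<close>

lemma module_rank_le_one_if:
  assumes rank_le_one
  shows "module_rank scale \<le> 1"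
proof -
  have "\<exists>x. \<forall>m. \<exists>d e. d \<noteq> 0 \<and> scale d m = scale e x"
  proof (cases "torsion = UNIV")
    case True
    then show ?thesis
      by (intro exI[of _ 0]) (auto simp: torsion_submodule_def)
  next
    case False
    then obtain x where x: "x \<notin> torsion" by blast
    have "\<exists>d e. d \<noteq> 0 \<and> scale d m = scale e x" for m
    proof -
      obtain d e where de: "d \<noteq> 0 \<or> e \<noteq> 0" "scale d m + scale e x = 0"
        using assms unfolding rank_le_one_def by blast
      have "d \<noteq> 0" using de x by (auto simp: torsion_submodule_def)
      moreover have "scale d m = scale (- e) x" using de(2) by (simp add: eq_neg_iff_add_eq_0)
      ultimately show ?thesis by blast
    qed
    then show ?thesis by blast
  qed
  then obtain x where x: "\<And>m. \<exists>d e. d \<noteq> 0 \<and> scale d m = scale e x" by blast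
  define v where "v = tcoset (frag_of (1, x))"
  have v: "v \<in> carrier (fract_tensor scale)" by (auto simp: v_def carrier_V)
  have U: "submodule class_ring (V.span {v}) (fract_tensor scale)"
    using v by (intro V.span_is_submodule) simp
  interpret U: submodule class_ring "V.span {v}" "fract_tensor scale" by (fact U)
  have vU: "v \<in> V.span {v}" using V.in_own_span[of "{v}"] v by simp
  have "tcoset (frag_of (q, m)) \<in> V.span {v}" for q m
  proof -
    obtain d e where de: "d \<noteq> 0" "scale d m = scale e x" using x by blast
    have "tcoset (frag_of (q, m)) = tcoset (frag_of (to_fract d * (q / to_fract d), m))"
      using de by simp
    also have "\<dots> = tcoset (frag_of (to_fract e * (q / to_fract d), x))"
      by (simp only: tcoset_balanced[symmetric] de)
    also have "\<dots> = (to_fract e * (q / to_fract d)) \<odot>\<^bsub>fract_tensor scale\<^esub> v"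
      by (simp add: v_def tcoset_smult)
    also have "\<dots> \<in> V.span {v}" using vU by (intro U.smult_closed) auto
    finally show ?thesis .
  qed
  then have "carrier (fract_tensor scale) \<subseteq> V.span {v}"
    using tcoset_in_submodule[OF U] by (auto simp: carrier_V)
  then have "V.gen_set {v}" using U.subset by blast
  then show ?thesis unfolding module_rank_def using v by (rule V.dim_le1I)
qed

text \<open>Independent \<open>x\<close> and \<open>y\<close> are separated by functionals, while on
  a space spanned by a single vector all functionals are proportional.\<close>

lemma module_rank_le_oneD:
  assumes fg: "finite S" "span S = UNIV" and rank: "module_rank scale \<le> 1"
  shows rank_le_one
  unfolding rank_le_one_def
proof (rule ccontr)
  assume "\<not> (\<forall>x y. \<exists>d e. (d \<noteq> 0 \<or> e \<noteq> 0) \<and> scale d x + scale e y = 0)"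
  then obtain x y where xy: "\<And>d e. scale d x + scale e y = 0 \<Longrightarrow> d = 0 \<and> e = 0" by blast
  have "scale d x \<noteq> scale e y" if "d \<noteq> 0" for d e using xy[of d "- e"] that by auto
  then obtain \<phi> where \<phi>: "Modules.module_hom scale (*) \<phi>" "\<phi> x \<noteq> 0" "\<phi> y = 0"
    using functional_exists[OF fg] by metis
  have "scale d y \<noteq> scale e x" if "d \<noteq> 0" for d e using xy[of "- e" d] that by auto
  then obtain \<psi> where \<psi>: "Modules.module_hom scale (*) \<psi>" "\<psi> y \<noteq> 0"
    using functional_exists[OF fg] by metis
  have "\<exists>n A. finite A \<and> card A = n \<and> A \<subseteq> carrier (fract_tensor scale) \<and> V.gen_set A"
    using V_fin_dim[OF fg] unfolding V.fin_dim_def by simp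
  from LeastI_ex[OF this, folded V.dim_def]
  obtain A where A: "finite A" "card A \<le> 1" "A \<subseteq> carrier (fract_tensor scale)" "V.gen_set A"
    using rank by (auto simp: module_rank_def)
  have "\<exists>v\<in>carrier (fract_tensor scale). \<forall>X\<in>carrier (fract_tensor scale). \<exists>k. X = k \<odot>\<^bsub>fract_tensor scale\<^esub> v"
  proof (cases "A = {}")
    case True
    have "X = 0 \<odot>\<^bsub>fract_tensor scale\<^esub> \<zero>\<^bsub>fract_tensor scale\<^esub>" if "X \<in> carrier (fract_tensor scale)" for X
      using V.finite_in_span[OF A(1,3), of X] that A(4) True V.smult_r_null[of 0]
      by (auto simp: V.lincomb_def)
    then show ?thesis by blast
  next
    case False
    then have "card A \<noteq> 0" using A(1) by simp
    then have "card A = 1" using A(2) by linarith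
    then obtain v where v: "A = {v}" by (rule card_1_singletonE)
    have "\<exists>k. X = k \<odot>\<^bsub>fract_tensor scale\<^esub> v" if X: "X \<in> carrier (fract_tensor scale)" for X
    proof -
      obtain a where "V.lincomb a A = X"
        using V.finite_in_span[OF A(1,3), of X] X A(4) by auto
      then show ?thesis using v A(3) by (auto simp: V.lincomb_def)
    qed
    then show ?thesis using v A(3) by blast
  qed
  then obtain c where c: "\<And>X. X \<in> carrier (fract_tensor scale) \<Longrightarrow> \<exists>k. X = k \<odot>\<^bsub>fract_tensor scale\<^esub> tcoset c"
    by (auto simp: carrier_V)
  \<comment> \<open>The coordinate \<open>k\<close> of \<open>1 \<otimes> m\<close> along the
    generator is the same for every functional.\<close>
  have "\<exists>k. \<forall>\<phi>. Modules.module_hom scale (*) \<phi> \<longrightarrow> to_fract (\<phi> m) = k * tensor_eval \<phi> c" for m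
  proof -
    let ?k = "\<lambda>k. frag_extend (\<lambda>(q, m). frag_of (k * q, m)) c"
    obtain k where "tcoset (frag_of (1, m)) = k \<odot>\<^bsub>fract_tensor scale\<^esub> tcoset c"
      using c[of "tcoset (frag_of (1, m))"] by (auto simp: carrier_V)
    then have null: "frag_of (1, m) - ?k k \<in> tensor_null fract_scale scale"
      by (simp add: smult_tensor_coset tensor_coset_eq_iff)
    have "to_fract (\<phi> m) = k * tensor_eval \<phi> c" if "Modules.module_hom scale (*) \<phi>" for \<phi>
      using tensor_eval_null[OF that null] by (simp add: tensor_eval_scale)
    then show ?thesis by blast
  qed
  then obtain k where k: "\<And>m \<phi>. Modules.module_hom scale (*) \<phi> \<Longrightarrow> to_fract (\<phi> m) = k m * tensor_eval \<phi> c"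
    by metis
  \<comment> \<open>From \<open>\<phi> x \<noteq> 0\<close> the value of \<open>\<phi>\<close> at
    the generator is nonzero, so \<open>\<phi> y = 0\<close> forces \<open>k y = 0\<close>, against
    \<open>\<psi> y \<noteq> 0\<close>.\<close>
  show False
    using k[OF \<phi>(1), of x] k[OF \<phi>(1), of y] k[OF \<psi>(1), of y] \<phi> \<psi> by auto
qed

section \<open>Necessity of the rank bound, and splitting off the torsion submodule\<close>

lemma rank_le_one_if_C4:
  assumes D: "dedekind_domain TYPE('a)" and nf: "\<not> field (class_ring :: 'a ring)"
    and fg: "finite S" "span S = UNIV" and C4: "C4_module scale UNIV"
  shows rank_le_one
  unfolding rank_le_one_def
proof (rule ccontr)
  assume "\<not> (\<forall>x y. \<exists>d e. (d \<noteq> 0 \<or> e \<noteq> 0) \<and> scale d x + scale e y = 0)"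
  then obtain x y where xy: "\<And>d e. scale d x + scale e y = 0 \<Longrightarrow> d = 0 \<and> e = 0" by blast
  have y: "e = 0" if "scale e y = 0" for e using xy[of 0 e] that by simp
  have "scale d x \<noteq> scale e y" if "d \<noteq> 0" for d e using xy[of d "- e"] that by auto
  then obtain \<phi> where \<phi>: "Modules.module_hom scale (*) \<phi>" "\<phi> x \<noteq> 0" "\<phi> y = 0"
    using functional_exists[OF fg] by metis
  interpret \<phi>: Modules.module_hom scale "(*)" \<phi> by (fact \<phi>)
  obtain \<pi> where \<pi>: "Modules.module_hom scale scale \<pi>" "\<And>m. \<phi> (\<pi> m) = \<phi> m" "\<And>m. \<phi> m = 0 \<Longrightarrow> \<pi> m = 0"
    using functional_splits[OF D \<phi>(1,2)] by metis
  let ?Q = "range \<pi>" and ?N = "{x. \<phi> x = 0}"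
  have sum: "internal_direct_sum scale UNIV ?Q ?N"
    using \<phi>(1) \<pi> by (rule functional_direct_sum)
  note E = internal_direct_sumD[OF sum]
  obtain d :: 'a where d: "d \<noteq> 0" "\<not> d dvd 1"
  proof -
    have "Units (class_ring :: 'a ring) \<noteq> UNIV - {0}"
    proof
      assume "Units (class_ring :: 'a ring) = UNIV - {0}"
      then have "field (class_ring :: 'a ring)"
        by (intro cring.cring_fieldI[OF class_cring.is_cring]) simp
      with nf show False ..
    qed
    moreover have "0 \<notin> Units (class_ring :: 'a ring)" by (auto simp: Units_def)
    ultimately obtain d where "d \<noteq> 0" "d \<notin> Units (class_ring :: 'a ring)" by auto
    then show ?thesis by (intro that[of d]) (auto simp: Units_def dvd_def mult.commute)
  qed
  \<comment> \<open>The values lie in \<open>?N\<close> because \<open>\<phi> y = 0\<close>;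
    \<open>f\<close> is injective on \<open>?Q\<close> because no nonzero scalar kills
    \<open>y\<close>.\<close>
  define f where "f q = scale (\<phi> q) (scale d y)" for q
  have "submodule_hom scale ?Q ?N f"
    by (auto simp: submodule_hom_def f_def \<phi>.add \<phi>.scale \<phi>(3) algebra_simps)
  moreover have "{q \<in> ?Q. f q = 0} = {0}"
  proof -
    have "f (\<pi> m) = 0 \<Longrightarrow> \<pi> m = 0" for m
      using y[of "\<phi> m * d"] d \<pi>(2,3)[of m] by (simp add: f_def)
    then show ?thesis using subspace_0[OF E(1)] by (auto simp: f_def)
  qed
  moreover have "direct_summand scale ?Q {0}"
  proof -
    have "internal_direct_sum scale ?Q {0} ?Q"
      using E(1) by (intro internal_direct_sumI) auto
    then show ?thesis by (auto simp: direct_summand_def)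
  qed
  ultimately have "direct_summand scale ?N (f ` ?Q)"
    using C4 sum unfolding C4_module_def by metis
  then obtain Z where "internal_direct_sum scale ?N (f ` ?Q) Z" by (auto simp: direct_summand_def)
  note G = internal_direct_sumD[OF this]
  have "d dvd 1"
  \<comment> \<open>Applied to the fraction \<open>1 / d\<close> and the image of
    \<open>\<phi>\<close>: the complement \<open>Z\<close> forces this image into \<open>d\<close>
    times itself.\<close>
  proof (rule integral_dvd)
    show "noetherian_ring (class_ring :: 'a ring)" "integrally_closed_domain TYPE('a)"
      using D by (simp_all add: dedekind_domain_def noetherian_domain_def)
    show "\<phi> x \<in> range \<phi>" by blast
    show "\<exists>j\<in>range \<phi>. 1 * i = d * j" if i: "i \<in> range \<phi>" for i
    proof -
      obtain m where m: "i = \<phi> m" using i by blast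
      have "scale i y \<in> ?N" by (simp add: \<phi>.scale \<phi>(3))
      then obtain n z where nz: "z \<in> Z" "scale i y = f (\<pi> n) + z" using G(6) by blast
      \<comment> \<open>Multiplying by \<open>d\<close> moves \<open>scale i y\<close> into the
        image of \<open>f\<close>, so \<open>scale d z\<close> lies in both summands and
        vanishes.\<close>
      have "scale d z = scale d (scale i y) - scale d (f (\<pi> n))"
        using nz(2) by (simp add: scale_right_distrib)
      also have "\<dots> = f (\<pi> (m - scale d n))"
        by (simp add: f_def \<pi>(2) m \<phi>.diff \<phi>.scale algebra_simps)
      finally have "scale d z \<in> f ` ?Q" by blast
      then have "scale d z = 0" using G(7) subspace_scale[OF G(2) nz(1)] by blast
      moreover have "scale (d * (i - d * \<phi> n)) y = scale d (scale i y - f (\<pi> n))"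
        by (simp add: f_def \<pi>(2) algebra_simps)
      ultimately have "scale (d * (i - d * \<phi> n)) y = 0" using nz(2) by simp
      then have "i = d * \<phi> n" using y d(1) by fastforce
      then show ?thesis by auto
    qed
  qed (use d \<phi> in auto)
  with d show False by blast
qed

text \<open>A functional nonzero at a nontorsion \<open>x\<close> kills torsion. Conversely, if it
  kills \<open>z\<close>, then in a dependence between \<open>x\<close> and \<open>z\<close> the
  coefficient of \<open>x\<close> is zero, so \<open>z\<close> is torsion. The kernel of a
  functional splits off.\<close>

lemma direct_summand_torsion:
  assumes D: "dedekind_domain TYPE('a)"
    and fg: "finite S" "span S = UNIV" and rank: rank_le_one
  shows "direct_summand scale UNIV torsion"
proof (cases "torsion = UNIV")
  case True
  have "internal_direct_sum scale UNIV UNIV {0}"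
    by (rule internal_direct_sumI) auto
  with True show ?thesis by (auto simp: direct_summand_def)
next
  case False
  then obtain x where x: "x \<notin> torsion" by blast
  \<comment> \<open>Being nontorsion is the independence hypothesis of
    \<open>functional_exists\<close> with \<open>y = 0\<close>.\<close>
  then have "scale d x \<noteq> scale e 0" if "d \<noteq> 0" for d e
    using that by (auto simp: torsion_submodule_def)
  then obtain \<phi> where \<phi>: "Modules.module_hom scale (*) \<phi>" "\<phi> x \<noteq> 0"
    using functional_exists[OF fg] by metis
  interpret \<phi>: Modules.module_hom scale "(*)" \<phi> by (fact \<phi>)
  obtain \<pi> where \<pi>: "Modules.module_hom scale scale \<pi>" "\<And>m. \<phi> (\<pi> m) = \<phi> m" "\<And>m. \<phi> m = 0 \<Longrightarrow> \<pi> m = 0"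
    using functional_splits[OF D \<phi>] by metis
  have "torsion = {z. \<phi> z = 0}"
  proof (intro subset_antisym subsetI)
    fix z assume "z \<in> torsion"
    then obtain d where d: "d \<noteq> 0" "scale d z = 0" by (auto simp: torsion_submodule_def)
    then have "d * \<phi> z = 0" using \<phi>.scale[of d z] by simp
    then show "z \<in> {z. \<phi> z = 0}" using d by simp
  next
    fix z assume z: "z \<in> {z. \<phi> z = 0}"
    obtain d e where de: "d \<noteq> 0 \<or> e \<noteq> 0" "scale d x + scale e z = 0"
      using rank unfolding rank_le_one_def by blast
    then have "d * \<phi> x = 0" using z \<phi>.add[of "scale d x" "scale e z"] by (simp add: \<phi>.scale)
    then have "d = 0" using \<phi>(2) by simp
    with de show "z \<in> torsion" by (auto simp: torsion_submodule_def)
  qed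
  then show ?thesis
    using internal_direct_sum_commute[OF functional_direct_sum[OF \<phi>(1) \<pi>]]
    by (auto simp: direct_summand_def)
qed

end

theorem corollary10p3:
  fixes scale :: "'a::idom \<Rightarrow> 'b::ab_group_add \<Rightarrow> 'b"
  assumes "dedekind_domain TYPE('a)"
    and "\<not> field (class_ring :: 'a ring)"
    and "Modules.module scale"
    and "\<exists>S. finite S \<and> Modules.module.span scale S = UNIV"
  shows "C4_module scale UNIV \<longleftrightarrow>
           module_rank scale \<le> 1 \<and> C4_module scale (torsion_submodule scale)"
proof -
  interpret domain_module scale using assms(3) by (rule domain_module.intro)
  obtain S where fg: "finite S" "span S = UNIV" using assms(4) by blast
  have "module_rank scale \<le> 1 \<longleftrightarrow> rank_le_one"
    using module_rank_le_one_if module_rank_le_oneD[OF fg] by blast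
  then show ?thesis
    \<comment> \<open>Forwards, torsion inherits C4 as a summand, which it is by the rank bound;
      backwards, the same splitting feeds \<open>C4_module_if_torsion\<close>.\<close>
    using rank_le_one_if_C4[OF assms(1,2) fg] direct_summand_torsion[OF assms(1) fg]
      C4_module_summand C4_module_if_torsion by blast
qed

end
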